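(* Let $\mathcal{G}\subseteq\mathrm{GL}_2(\mathbb{Z})$ be the integer representation of the Weyl group of type $\mathrm{G}_2$ with respect to the fundamental weights, and let $\mathcal{T}$, $\mathcal{T}_{\mathbb{R}}$ be its $\mathbb{T}$-orbit space and real $\mathbb{T}$-orbit space. Let \[ C(z)=\begin{bmatrix}0&0&(9z_1^2-3z_1-3z_2-1)/2\\1&0&-3(z_1+z_2)/2\\0&1&3z_1\end{bmatrix}\in\mathbb{Q}[z_1,z_2]^{3\times3} \] and define $H\in\mathbb{Q}[z_1,z_2]^{3\times3}$ by $H(z)_{ij}=\mathrm{Tr}\big(C(z)^{i+j-2}-C(z)^{i+j}\big)$. Then \[ \mathcal{T}=\mathcal{T}_{\mathbb{R}}=\{z\in\mathbb{R}^2\mid H(z)\succeq0\}. \]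
   Context: $\mathbb{T}=\{x\in\mathbb{C}\mid|x|=1\}$; $\succeq0$ means positive semidefinite. The integer representation (matrices of the Weyl group $\mathfrak{S}_3\ltimes\{\pm1\}$ in the basis of fundamental weights) is \[ \mathcal{G}=\left\{\pm\begin{bmatrix}1&0\\0&1\end{bmatrix},\pm\begin{bmatrix}-1&0\\1&1\end{bmatrix},\pm\begin{bmatrix}1&3\\0&-1\end{bmatrix},\pm\begin{bmatrix}1&3\\-1&-2\end{bmatrix},\pm\begin{bmatrix}2&3\\-1&-1\end{bmatrix},\pm\begin{bmatrix}2&3\\-1&-2\end{bmatrix}\right\}. \] For $x\in(\mathbb{C}^* )^2$, $\alpha\in\mathbb{Z}^2$, $x^\alpha=x_1^{\alpha_1}x_2^{\alpha_2}$; $\theta_i(x)=\frac1{12}\sum_{B\in\mathcal{G}}x^{Be_i}$ for $i=1,2$ ($e_1,e_2$ standard basis of $\mathbb{Z}^2$). The $\mathbb{T}$-orbit space is $\mathcal{T}=\{(\theta_1(x),\theta_2(x))\mid x\in\mathbb{T}^2\}$. Since $-I_2\in\mathcal{G}$, the $\theta_i$ are real-valued on $\mathbb{T}^2$, and the real $\mathbb{T}$-orbit space $\mathcal{T}_{\mathbb{R}}\subseteq\mathbb{R}^2$ is by definition the image of the same map on $\mathbb{T}^2$. *)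

theory Defs
  imports "HOL-Analysis.Analysis"
begin

text \<open>
  The Weyl group of type \<open>G\<^sub>2\<close> in the basis of fundamental weights (first one short): column j
  is the image of the j-th fundamental weight. The set has 12 elements.
\<close>

definition weylG2 :: "(int^2^2) set" where
  "weylG2 =
    (let R = {vector [vector [1, 0], vector [0, 1]],
              vector [vector [-1, 0], vector [1, 1]],
              vector [vector [1, 3], vector [0, -1]],
              vector [vector [1, 3], vector [-1, -2]],
              vector [vector [2, 3], vector [-1, -1]],
              vector [vector [2, 3], vector [-1, -2]]}
     in R \<union> uminus ` R)"

definition monomial :: "complex^2 \<Rightarrow> int^2 \<Rightarrow> complex" where
  "monomial x a = (\<Prod>i\<in>UNIV. x $ i powi a $ i)"

definition theta :: "2 \<Rightarrow> complex^2 \<Rightarrow> complex" where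
  "theta i x = 1/12 * (\<Sum>B\<in>weylG2. monomial x (B *v axis i 1))"

definition torus2 :: "(complex^2) set" where
  "torus2 = {x. \<forall>i. norm (x $ i) = 1}"

definition orbit_space :: "(complex^2) set" where
  "orbit_space = (\<lambda>x. \<chi> i. theta i x) ` torus2"

text \<open>
  Taking real parts only serves to turn the values of theta into type real: theta is
  real-valued on the torus, since the group contains minus the identity.
\<close>

definition real_orbit_space :: "(real^2) set" where
  "real_orbit_space = (\<lambda>x. \<chi> i. Re (theta i x)) ` torus2"

definition complex_vec :: "real^'n \<Rightarrow> complex^'n" where
  "complex_vec z = (\<chi> i. complex_of_real (z $ i))"

definition C_mat :: "real^2 \<Rightarrow> real^3^3" where
  "C_mat z = vector
    [vector [0, 0, (9 * (z$1)^2 - 3 * z$1 - 3 * z$2 - 1) / 2],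
     vector [1, 0, - 3 * (z$1 + z$2) / 2],
     vector [0, 1, 3 * z$1]]"

text \<open>The product \<open>*\<close> (hence \<open>^\<close>) on type vec is not the matrix product.\<close>

primrec mat_power :: "'a::semiring_1^'n^'n \<Rightarrow> nat \<Rightarrow> 'a^'n^'n" where
  "mat_power A 0 = mat 1"
| "mat_power A (Suc k) = A ** mat_power A k"

definition H_entry :: "real^2 \<Rightarrow> nat \<Rightarrow> nat \<Rightarrow> real" where
  "H_entry z i j = trace (mat_power (C_mat z) (i + j - 2) - mat_power (C_mat z) (i + j))"

text \<open>
  The entries are listed because the exponents need the row and column numbers 1, 2, 3 as
  natural numbers, whereas matrices are indexed by the type 3 (in which 3 = 0).
\<close>

definition H_mat :: "real^2 \<Rightarrow> real^3^3" where
  "H_mat z = vector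
    [vector [H_entry z 1 1, H_entry z 1 2, H_entry z 1 3],
     vector [H_entry z 2 1, H_entry z 2 2, H_entry z 2 3],
     vector [H_entry z 3 1, H_entry z 3 2, H_entry z 3 3]]"

definition psd :: "real^'n^'n \<Rightarrow> bool" where
  "psd A \<longleftrightarrow> transpose A = A \<and> (\<forall>v. 0 \<le> v \<bullet> (A *v v))"

end

theory Submission
  imports Defs
begin

text \<open>
  With \<open>x = (cis s, cis (s - t))\<close> the first weight has the orbit \<open>cis (\<plusminus>s)\<close>, \<open>cis (\<plusminus>t)\<close>,
  \<open>cis (\<plusminus>(s + t))\<close> of monomials, so \<open>z\<close> lies in the orbit space iff the companion matrix \<open>C(z)\<close> has eigenvalues
  \<open>cos s\<close>, \<open>cos t\<close>, \<open>cos (s + t)\<close>: the entries of \<open>C(z)\<close> express \<open>z\<close> and the relation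
  \<open>a\<^sup>2 + b\<^sup>2 + c\<^sup>2 - 2 a b c = 1\<close>, which for \<open>a\<close>, \<open>b\<close> in \<open>[-1, 1]\<close> characterises triples of
  cosines of this form. On the other side, \<open>v\<^sup>T H(z) v\<close> is the sum of \<open>(1 - \<lambda>\<^sup>2) q(\<lambda>)\<^sup>2\<close>
  over the eigenvalues \<open>\<lambda>\<close>, where \<open>q\<close> is the polynomial with coefficient vector \<open>v\<close>. A suitable
  interpolating \<open>q\<close> makes this negative as soon as some \<open>\<lambda>\<close> is nonreal or lies outside \<open>[-1, 1]\<close>.
\<close>

section \<open>Cosine formulas for \<open>theta\<close> on the torus\<close>

lemma monomial_cis:
  "monomial (vector [cis a, cis b]) \<alpha> = cis (of_int (\<alpha> $ 1) * a + of_int (\<alpha> $ 2) * b)"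
  by (simp add: monomial_def UNIV_2 cis_power_int cis_mult)

text \<open>Pairing each matrix with its negative lets conjugate monomials add up to cosines in
  \<open>theta_cis\<close>.\<close>

lemma sum_weylG2:
  fixes f :: "int^2^2 \<Rightarrow> complex"
  shows "sum f weylG2 = (\<Sum>B\<leftarrow>[vector [vector [1, 0], vector [0, 1]],
              vector [vector [-1, 0], vector [1, 1]],
              vector [vector [1, 3], vector [0, -1]],
              vector [vector [1, 3], vector [-1, -2]],
              vector [vector [2, 3], vector [-1, -1]],
              vector [vector [2, 3], vector [-1, -2]]]. f B + f (- B))"
proof -
  let ?L = "[vector [vector [1, 0], vector [0, 1]],
              vector [vector [-1, 0], vector [1, 1]],
              vector [vector [1, 3], vector [0, -1]],
              vector [vector [1, 3], vector [-1, -2]],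
              vector [vector [2, 3], vector [-1, -1]],
              vector [vector [2, 3], vector [-1, -2]]] :: (int^2^2) list"
  have W: "weylG2 = set ?L \<union> uminus ` set ?L"
    by (simp add: weylG2_def Let_def)
  have disj: "set ?L \<inter> uminus ` set ?L = {}"
    by (auto simp: vec_eq_iff forall_2)
  have dist: "distinct ?L"
    by (simp add: vec_eq_iff forall_2)
  have "sum f weylG2 = sum f (set ?L) + sum f (uminus ` set ?L)"
    unfolding W by (rule sum.union_disjoint) (use disj in simp_all)
  also have "sum f (uminus ` set ?L) = (\<Sum>B\<in>set ?L. f (- B))"
    by (rule sum.reindex [unfolded o_def]) (rule inj_on_subset [OF inj_uminus subset_UNIV])
  also have "sum f (set ?L) + \<dots> = (\<Sum>B\<in>set ?L. f B + f (- B))"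
    by (simp only: sum.distrib)
  also have "\<dots> = (\<Sum>B\<leftarrow>?L. f B + f (- B))"
    by (rule sum_list_distinct_conv_sum_set [symmetric, OF dist])
  finally show ?thesis .
qed

lemma cis_add_cis_minus: "cis t + cis (- t) = of_real (2 * cos t)"
  by (simp add: complex_eq_iff)

lemma theta_cis:
  fixes s t :: real
  defines "x \<equiv> vector [cis s, cis (s - t)]"
  shows "theta 1 x = of_real ((cos s + cos t + cos (s + t)) / 3)"
    and "theta 2 x = of_real ((cos (s - t) + cos (s + (s + t)) + cos (t + (s + t))) / 3)"
proof -
  have mult_axis: "(B *v axis i 1) $ j = B $ j $ i" for B :: "int^2^2" and i j
    by (simp add: matrix_vector_mult_def axis_def if_distrib cong: if_cong)
  have M: "monomial x (B *v axis i 1) + monomial x (- B *v axis i 1)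
      = of_real (2 * cos (of_int (B $ 1 $ i) * s + of_int (B $ 2 $ i) * (s - t)))"
    for B :: "int^2^2" and i
  proof -
    let ?u = "of_int (B $ 1 $ i) * s + of_int (B $ 2 $ i) * (s - t)"
    have "monomial x (B *v axis i 1) + monomial x (- B *v axis i 1) = cis ?u + cis (- ?u)"
      by (simp add: x_def monomial_cis mult_axis)
    then show ?thesis by (simp only: cis_add_cis_minus)
  qed
  have flip: "cos (- s - t) = cos (s + t)" "cos (t - s) = cos (s - t)" for s t :: real
    using cos_minus [of "s + t"] cos_minus [of "s - t"] by simp_all
  show "theta 1 x = of_real ((cos s + cos t + cos (s + t)) / 3)"
    unfolding theta_def sum_weylG2 M
    by (simp add: algebra_simps flip)
  show "theta 2 x = of_real ((cos (s - t) + cos (s + (s + t)) + cos (t + (s + t))) / 3)"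
    unfolding theta_def sum_weylG2 M
    by (simp add: algebra_simps flip)
qed

lemma torus2_cis:
  assumes "x \<in> torus2"
  obtains s t where "x = vector [cis s, cis (s - t)]"
proof -
  have "norm (x $ 1) = 1" "norm (x $ 2) = 1" using assms by (auto simp: torus2_def)
  then obtain a b where "x $ 1 = cis a" "x $ 2 = cis b"
    by (metis cis_Arg norm_eq_zero zero_neq_one sgn_div_norm scaleR_one div_by_1 inverse_1)
  then have "x = vector [cis a, cis (a - (a - b))]"
    by (simp add: vec_eq_iff forall_2)
  then show ?thesis using that by blast
qed

lemma vector_cis_in_torus2: "vector [cis a, cis b] \<in> torus2"
  by (simp add: torus2_def forall_2)

section \<open>Characteristic polynomial of \<open>C_mat\<close> and Hermite form of
  \<open>H_mat\<close>\<close>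

definition char_coeff1 :: "real^2 \<Rightarrow> real" where
  "char_coeff1 z = 3 * z$1"

definition char_coeff2 :: "real^2 \<Rightarrow> real" where
  "char_coeff2 z = 3 * (z$1 + z$2) / 2"

definition char_coeff3 :: "real^2 \<Rightarrow> real" where
  "char_coeff3 z = (9 * (z$1)^2 - 3 * z$1 - 3 * z$2 - 1) / 2"

text \<open>Vieta's formulas record the roots of the characteristic polynomial of
  \<open>C_mat z\<close> with multiplicity. The type variable admits both real and complex
  triples.\<close>

definition char_roots :: "real^2 \<Rightarrow> 'a::real_algebra_1 \<Rightarrow> 'a \<Rightarrow> 'a \<Rightarrow> bool" where
  "char_roots z a b c \<longleftrightarrow> a + b + c = of_real (char_coeff1 z)
    \<and> a * b + a * c + b * c = of_real (char_coeff2 z)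
    \<and> a * b * c = of_real (char_coeff3 z)"

lemmas char_coeff_defs = char_coeff1_def char_coeff2_def char_coeff3_def

lemma C_mat_companion:
  "C_mat z = vector [vector [0, 0, char_coeff3 z], vector [1, 0, - char_coeff2 z],
     vector [0, 1, char_coeff1 z]]"
proof -
  have "- 3 * (z$1 + z$2) / 2 = - char_coeff2 z" by (simp add: char_coeff2_def field_simps)
  then show ?thesis unfolding C_mat_def by (simp only: char_coeff1_def char_coeff3_def)
qed

text \<open>The factor \<open>A\<close> matches the left recursion of \<open>mat_power\<close>:
  taking a power for \<open>A\<close> gives the recurrence for all higher powers.\<close>

lemma C_mat_cayley_hamilton:
  "C_mat z ** (C_mat z ** (C_mat z ** A)) = char_coeff1 z *\<^sub>R (C_mat z ** (C_mat z ** A))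
     - char_coeff2 z *\<^sub>R (C_mat z ** A) + char_coeff3 z *\<^sub>R A"
  unfolding C_mat_companion
  by (simp add: vec_eq_iff forall_3 matrix_matrix_mult_def sum_3 algebra_simps)

lemma trace_scaleR: "trace (c *\<^sub>R A) = c * trace (A :: real^'n^'n)"
  by (simp add: trace_def sum_distrib_left)

text \<open>By Cayley-Hamilton the traces satisfy the same third-order recurrence as the power sums
  of the roots, and both sequences agree at 0, 1 and 2.\<close>

lemma trace_mat_power_C_mat:
  fixes a b c :: complex
  assumes "char_roots z a b c"
  shows "of_real (trace (mat_power (C_mat z) k)) = a ^ k + b ^ k + c ^ k"
proof -
  define e1 e2 e3 where e: "e1 = char_coeff1 z" "e2 = char_coeff2 z" "e3 = char_coeff3 z"
  have el: "of_real e1 = a + b + c" "of_real e2 = a * b + a * c + b * c" "of_real e3 = a * b * c"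
    using assms by (simp_all add: char_roots_def e)
  have C: "C_mat z = vector [vector [0, 0, e3], vector [1, 0, - e2], vector [0, 1, e1]]"
    by (simp add: C_mat_companion e)
  show ?thesis
  proof (induction k rule: less_induct)
    case (less k)
    consider "k = 0" | "k = 1" | "k = 2" | m where "k = Suc (Suc (Suc m))"
      by (metis One_nat_def Suc_1 not0_implies_Suc)
    then show ?case
    proof cases
      case 1
      then show ?thesis by (simp add: trace_def mat_def)
    next
      case 2
      then show ?thesis by (simp add: C trace_def sum_3 el)
    next
      case 3
      have "trace (mat_power (C_mat z) 2) = e1 ^ 2 - 2 * e2"
        by (simp add: numeral_2_eq_2 C trace_def sum_3 matrix_matrix_mult_def
            mat_def power2_eq_square)
      then show ?thesis
        using 3 by (simp add: el del: mat_power.simps) (simp add: power2_eq_square algebra_simps)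
    next
      case (4 m)
      let ?t = "\<lambda>k. trace (mat_power (C_mat z) k)"
      have "?t k = e1 * ?t (Suc (Suc m)) - e2 * ?t (Suc m) + e3 * ?t m"
        by (simp add: 4 C_mat_cayley_hamilton trace_add trace_sub trace_scaleR e)
      moreover have "of_real (?t j) = a ^ j + b ^ j + c ^ j" if "j < k" for j
        using less that by blast
      ultimately have "of_real (?t k) = of_real e1 * (a ^ Suc (Suc m) + b ^ Suc (Suc m) + c ^ Suc (Suc m))
          - of_real e2 * (a ^ Suc m + b ^ Suc m + c ^ Suc m) + of_real e3 * (a ^ m + b ^ m + c ^ m)"
        by (simp add: 4 del: mat_power.simps power_Suc)
      then show ?thesis
        unfolding el by (simp add: 4 algebra_simps del: mat_power.simps)
    qed
  qed
qed

text \<open>\<open>H_mat z\<close> is the Hankel matrix of the power sums weighted by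
  \<open>1 - w^2\<close>, hence a sum of rank-one forms, one for each root \<open>w\<close>, built
  from the vector \<open>(1, w, w^2)\<close>.\<close>

lemma quadratic_form_H_mat:
  fixes a b c :: complex
  assumes "char_roots z a b c"
  defines "q \<equiv> \<lambda>v w. of_real (v$1) + of_real (v$2) * w + of_real (v$3) * w^2"
  shows "of_real (v \<bullet> (H_mat z *v v))
    = (1 - a^2) * q v a ^ 2 + (1 - b^2) * q v b ^ 2 + (1 - c^2) * q v c ^ 2"
proof -
  have E: "of_real (H_entry z i j) = (1 - a^2) * a ^ (i + j - 2) + (1 - b^2) * b ^ (i + j - 2)
      + (1 - c^2) * c ^ (i + j - 2)" if "i \<ge> 1" "j \<ge> 1" for i j
  proof -
    \<comment> \<open>Natural subtraction truncates; \<open>i\<close> and \<open>j\<close> being at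
      least 1 makes it exact here.\<close>
    have "i + j = i + j - 2 + 2" using that by simp
    then have "of_real (H_entry z i j) = a ^ (i + j - 2) + b ^ (i + j - 2) + c ^ (i + j - 2)
        - (a ^ (i + j - 2 + 2) + b ^ (i + j - 2 + 2) + c ^ (i + j - 2 + 2))"
      by (metis H_entry_def trace_sub of_real_diff trace_mat_power_C_mat [OF assms(1)])
    then show ?thesis by (simp only: power_add) (simp add: algebra_simps)
  qed
  have "v \<bullet> (H_mat z *v v) =
     v$1 * v$1 * H_entry z 1 1 + v$2 * v$2 * H_entry z 2 2 + v$3 * v$3 * H_entry z 3 3
     + v$1 * v$2 * (H_entry z 1 2 + H_entry z 2 1) + v$1 * v$3 * (H_entry z 1 3 + H_entry z 3 1)
     + v$2 * v$3 * (H_entry z 2 3 + H_entry z 3 2)"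
    by (simp add: inner_vec_def matrix_vector_mult_def H_mat_def sum_3 algebra_simps)
  then show ?thesis
    by (simp add: E q_def) (simp add: power2_eq_square numeral_eq_Suc algebra_simps)
qed

lemma transpose_H_mat: "transpose (H_mat z) = H_mat z"
  by (simp add: H_mat_def transpose_def vec_eq_iff forall_3 H_entry_def add.commute)

lemma char_roots_of_real:
  "char_roots z (complex_of_real a) (of_real b) (of_real c) \<longleftrightarrow> char_roots z a b c"
  unfolding char_roots_def
  by (simp only: of_real_add [symmetric] of_real_mult [symmetric] of_real_eq_iff) simp

lemma quadratic_form_H_mat_real:
  fixes a b c :: real
  assumes "char_roots z a b c"
  defines "q \<equiv> \<lambda>v w. v$1 + v$2 * w + v$3 * w^2"
  shows "v \<bullet> (H_mat z *v v)
    = (1 - a^2) * q v a ^ 2 + (1 - b^2) * q v b ^ 2 + (1 - c^2) * q v c ^ 2"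
proof -
  have "complex_of_real (v \<bullet> (H_mat z *v v))
    = of_real ((1 - a^2) * q v a ^ 2 + (1 - b^2) * q v b ^ 2 + (1 - c^2) * q v c ^ 2)"
    using quadratic_form_H_mat [OF char_roots_of_real [THEN iffD2, OF assms(1)], of v]
    by (simp add: q_def)
  then show ?thesis by (simp only: of_real_eq_iff)
qed

section \<open>Positive semidefiniteness and the location of the roots\<close>

lemma psd_H_mat_if_roots_le_1:
  fixes a b c :: real
  assumes "char_roots z a b c" "\<bar>a\<bar> \<le> 1" "\<bar>b\<bar> \<le> 1" "\<bar>c\<bar> \<le> 1"
  shows "psd (H_mat z)"
  using assms(2-) unfolding psd_def quadratic_form_H_mat_real [OF assms(1)]
  by (auto simp: transpose_H_mat abs_square_le_1)

lemma root_le_1_if_psd_H_mat: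
  fixes a b c :: real
  assumes "char_roots z a b c" "psd (H_mat z)"
  shows "\<bar>a\<bar> \<le> 1"
proof (rule ccontr)
  assume "\<not> \<bar>a\<bar> \<le> 1"
  then have neg: "1 - a^2 < 0" by (simp add: abs_square_le_1 not_le [symmetric])
  \<comment> \<open>The test polynomial \<open>p\<close> is the product of \<open>x - b\<close> and
    \<open>x - c\<close>, with a factor replaced by 1 if its root equals \<open>a\<close>. So
    \<open>p\<close> vanishes at the roots different from \<open>a\<close>, but not at
    \<open>a\<close>.\<close>
  define k l :: "real \<Rightarrow> real"
    where "k w = (if w = a then 1 else - w)" and "l w = (if w = a then 0 else 1)" for w
  define p where "p x = (k b + l b * x) * (k c + l c * x)" for x
  define v :: "real^3" where "v = vector [k b * k c, k b * l c + l b * k c, l b * l c]"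
  have "v$1 + v$2 * x + v$3 * x^2 = p x" for x
    by (simp add: v_def p_def power2_eq_square algebra_simps)
  then have form: "v \<bullet> (H_mat z *v v)
      = (1 - a^2) * p a ^ 2 + (1 - b^2) * p b ^ 2 + (1 - c^2) * p c ^ 2"
    using quadratic_form_H_mat_real [OF assms(1)] by simp
  have "p a \<noteq> 0" by (simp add: p_def k_def l_def)
  then have "(1 - a^2) * p a ^ 2 < 0" using neg by (simp add: mult_neg_pos)
  \<comment> \<open>A repetition of \<open>a\<close> carries the same negative weight, so it cannot
    compensate.\<close>
  moreover have rest: "(1 - w^2) * p w ^ 2 \<le> 0" if "w \<in> {b, c}" for w
  proof (cases "w = a")
    case True
    then show ?thesis using neg by (simp add: mult_nonpos_nonneg)
  next
    case False
    then have "p w = 0" using that by (auto simp: p_def k_def l_def)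
    then show ?thesis by simp
  qed
  ultimately have "v \<bullet> (H_mat z *v v) < 0"
    using rest [of b, simplified] rest [of c, simplified] unfolding form by linarith
  then show False using assms(2) by (simp add: psd_def not_le [symmetric])
qed

text \<open>A factor \<open>x - r\<close> removes the real root from the form. The remaining real
  linear factor is chosen so that \<open>w\<close> contributes a negative real number; its conjugate
  then contributes the same.\<close>

lemma not_psd_H_mat_if_nonreal_root:
  fixes r :: real and w :: complex
  assumes "char_roots z (of_real r) w (cnj w)" "Im w \<noteq> 0"
  shows "\<not> psd (H_mat z)"
proof
  assume psd: "psd (H_mat z)"
  \<comment> \<open>The contribution of \<open>w\<close> if the linear factor were 1 there. It is
    nonzero because its zeros 1, -1 and \<open>r\<close> are real.\<close>
  define K where "K = (1 - w^2) * (w - of_real r)^2"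
  have "K \<noteq> 0"
  proof
    assume "K = 0"
    then have "w^2 = 1 \<or> w = of_real r" by (simp add: K_def)
    then have "w = 1 \<or> w = - 1 \<or> w = of_real r" by (simp add: power2_eq_1_iff)
    then show False using assms(2) by auto
  qed
  \<comment> \<open>The product \<open>K u\<^sup>2\<close> is negative, and a linear polynomial with real coefficients takes the value \<open>u\<close>
    at the nonreal number \<open>w\<close>.\<close>
  define u where "u = \<i> * csqrt (cnj K)"
  define m where "m = Im u / Im w"
  define n where "n = Re u - m * Re w"
  have u: "of_real n + of_real m * w = u"
    using assms(2) by (simp add: complex_eq_iff n_def m_def)
  define p where "p x = (x - of_real r) * (of_real n + of_real m * x)" for x :: complex
  define v :: "real^3" where "v = vector [- r * n, n - r * m, m]"
  have vp: "of_real (v$1) + of_real (v$2) * x + of_real (v$3) * x^2 = p x" for x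
    by (simp add: v_def p_def power2_eq_square algebra_simps)
  have w: "(1 - w^2) * p w ^ 2 = - of_real ((cmod K)^2)"
  proof -
    have "(1 - w^2) * p w ^ 2 = K * u^2"
      by (simp add: p_def K_def u power_mult_distrib)
    also have "\<dots> = - (K * cnj K)"
      by (simp add: u_def power_mult_distrib)
    finally show ?thesis by (simp only: complex_norm_square)
  qed
  have "p (cnj w) = cnj (p w)" by (simp add: p_def)
  then have "(1 - (cnj w)^2) * p (cnj w) ^ 2 = cnj ((1 - w^2) * p w ^ 2)" by simp
  then have cw: "(1 - (cnj w)^2) * p (cnj w) ^ 2 = - of_real ((cmod K)^2)"
    unfolding w by simp
  have "p (of_real r) = 0" by (simp add: p_def)
  then have "complex_of_real (v \<bullet> (H_mat z *v v)) = of_real (- 2 * (cmod K)^2)"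
    unfolding quadratic_form_H_mat [OF assms(1)] vp w cw by simp
  then have "v \<bullet> (H_mat z *v v) < 0"
    using \<open>K \<noteq> 0\<close> unfolding of_real_eq_iff by simp
  then show False using psd by (simp add: psd_def not_le [symmetric])
qed

section \<open>Existence of the roots\<close>

lemma real_cubic_root:
  fixes a b c :: real
  obtains r where "r^3 - a * r^2 + b * r - c = 0"
proof -
  define f where "f x = x^3 - a * x^2 + b * x - c" for x
  \<comment> \<open>A Cauchy-type bound: at \<open>M\<close> and \<open>-M\<close> the cube
    dominates the lower terms, which fixes the signs for the intermediate value theorem.\<close>
  define M where "M = 1 + \<bar>a\<bar> + \<bar>b\<bar> + \<bar>c\<bar>"
  have bound: "\<bar>a * x^2\<bar> + \<bar>b * x\<bar> + \<bar>c\<bar> \<le> M ^ 3" if "\<bar>x\<bar> = M" for x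
  proof -
    have M1: "M \<ge> 1" "M^2 \<ge> 1" "M \<le> M^2" by (auto simp: M_def power2_eq_square algebra_simps)
    have "\<bar>a * x^2\<bar> + \<bar>b * x\<bar> + \<bar>c\<bar> = \<bar>a\<bar> * M^2 + \<bar>b\<bar> * M + \<bar>c\<bar> * 1"
      using that by (simp add: abs_mult power2_eq_square)
    also have "\<dots> \<le> \<bar>a\<bar> * M^2 + \<bar>b\<bar> * M^2 + \<bar>c\<bar> * M^2"
      using M1 by (intro add_mono mult_left_mono) auto
    also have "\<dots> \<le> M * M^2"
      by (simp add: M_def algebra_simps)
    finally show ?thesis by (simp add: power3_eq_cube power2_eq_square)
  qed
  have "M \<ge> 0" by (simp add: M_def)
  then have "\<bar>a * M^2\<bar> + \<bar>b * M\<bar> + \<bar>c\<bar> \<le> M ^ 3"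
    using bound [of M] by simp
  then have "f (- M) \<le> 0" "0 \<le> f M"
    by (simp_all add: f_def)
  moreover have "continuous_on {-M..M} f"
    unfolding f_def by (intro continuous_intros)
  moreover have "- M \<le> M" by (simp add: M_def)
  ultimately obtain r where "f r = 0" using IVT' [of f "-M" 0 M] by blast
  then show ?thesis using that by (simp add: f_def)
qed

lemma char_roots_cases:
  fixes z :: "real^2"
  obtains a b c :: real where "char_roots z a b c"
  | r and w :: complex where "char_roots z (of_real r) w (cnj w)" "Im w \<noteq> 0"
proof -
  define e1 e2 e3 where e: "e1 = char_coeff1 z" "e2 = char_coeff2 z" "e3 = char_coeff3 z"
  obtain r where r: "r^3 - e1 * r^2 + e2 * r - e3 = 0"
    by (rule real_cubic_root)
  \<comment> \<open>The other two roots are those of \<open>X\<^sup>2 - 2 h X + k\<close>.\<close>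
  define h k where "h = (e1 - r) / 2" and "k = e2 - r * (e1 - r)"
  have e1: "e1 = r + 2 * h" and e2: "e2 = k + 2 * h * r"
    by (simp_all add: h_def k_def field_simps)
  \<comment> \<open>Division by \<open>X - r\<close> leaves no remainder because \<open>r\<close> is
    a root.\<close>
  have e3: "e3 = r * k"
    using r unfolding e1 e2 by (simp add: power2_eq_square power3_eq_cube algebra_simps)
  \<comment> \<open>The sign of the discriminant \<open>h^2 - k\<close> separates a real pair from a
    conjugate pair.\<close>
  show ?thesis
  proof (cases "k \<le> h^2")
    case True
    define d where "d = sqrt (h^2 - k)"
    have k: "k = h * h - d * d" using True by (simp add: d_def power2_eq_square)
    then have "char_roots z r (h + d) (h - d)"
      unfolding char_roots_def e [symmetric] e1 e2 e3 k
      by (simp add: algebra_simps)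
    then show ?thesis by (rule that(1))
  next
    case False
    define d where "d = sqrt (k - h^2)"
    have k: "k = h * h + d * d" using False by (simp add: d_def power2_eq_square)
    then have "char_roots z (of_real r) (Complex h d) (cnj (Complex h d))"
      unfolding char_roots_def e [symmetric] e1 e2 e3 k
      by (simp add: complex_eq_iff algebra_simps)
    moreover have "Im (Complex h d) \<noteq> 0" using False by (simp add: d_def)
    ultimately show ?thesis by (rule that(2))
  qed
qed

section \<open>Triples of cosines as roots\<close>

lemma char_roots_cos:
  "char_roots (vector [(cos s + cos t + cos (s + t)) / 3,
     (cos (s - t) + cos (s + (s + t)) + cos (t + (s + t))) / 3])
     (cos s) (cos t) (cos (s + t))"
proof -
  have sum_diff: "cos (x + y) + cos (x - y) = 2 * cos x * cos y" for x y :: real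
    by (simp add: cos_add cos_diff)
  have E: "cos (s - t) = 2 * cos s * cos t - cos (s + t)"
    "cos (s + (s + t)) = 2 * cos s * cos (s + t) - cos t"
    "cos (t + (s + t)) = 2 * cos t * cos (s + t) - cos s"
    using sum_diff [of s t] sum_diff [of "s + t" s] sum_diff [of "s + t" t]
    by (simp_all add: algebra_simps)
  \<comment> \<open>The cubic relation between the three cosines, needed for the third coefficient,
    with the square completed.\<close>
  have "(cos (s + t) - cos s * cos t)^2 = (1 - (cos s)^2) * (1 - (cos t)^2)"
    by (simp add: cos_add power_mult_distrib sin_squared_eq [symmetric])
  then show ?thesis
    unfolding char_roots_def char_coeff_defs E
    by (simp add: field_simps power2_eq_square)
qed

lemma char_roots_cosE:
  fixes a b c :: real
  assumes "char_roots z a b c" "\<bar>a\<bar> \<le> 1" "\<bar>b\<bar> \<le> 1"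
  obtains s t where "a = cos s" "b = cos t" "c = cos (s + t)"
proof -
  define s t where "s = arccos a" and "t = arccos b"
  have st: "a = cos s" "b = cos t" using assms by (simp_all add: s_def t_def abs_le_iff)
  have "9 * (z$1)^2 - 3 * z$1 - 3 * z$2 - 1 = 2 * (a * b * c)"
    "3 * z$1 = a + b + c" "3 * (z$1 + z$2) = 2 * (a * b + a * c + b * c)"
    using assms(1) by (simp_all add: char_roots_def char_coeff_defs)
  moreover have "9 * (z$1)^2 = (3 * z$1)^2" by simp
  \<comment> \<open>Eliminating \<open>z\<close> from the three coefficients leaves the cubic
    relation.\<close>
  ultimately have "(a + b + c)^2 - 2 * (a * b + a * c + b * c) - 1 = 2 * (a * b * c)"
    by (simp only:) (simp add: algebra_simps)
  then have "(c - a * b)^2 = (1 - a^2) * (1 - b^2)"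
    by (simp add: power2_eq_square algebra_simps)
  also have "\<dots> = (sin s * sin t)^2"
    by (simp add: st sin_squared_eq power_mult_distrib)
  finally have "c - a * b = sin s * sin t \<or> c - a * b = - (sin s * sin t)"
    by (simp only: power2_eq_iff)
  \<comment> \<open>The sign ambiguity is absorbed by replacing \<open>t\<close> with
    \<open>-t\<close>, which preserves \<open>cos t\<close>.\<close>
  then have "c = cos (s + t) \<or> c = cos (s + - t)"
    unfolding cos_add by (auto simp: st)
  then show ?thesis
    using that st by (metis cos_minus)
qed

text \<open>The first coefficient fixes \<open>z$1\<close>, and then the second fixes
  \<open>z$2\<close>.\<close>

lemma char_roots_inject:
  fixes a b c :: real
  assumes "char_roots z a b c" "char_roots z' a b c"
  shows "z = z'"
  using assms by (simp add: char_roots_def char_coeff_defs vec_eq_iff forall_2)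

theorem theorem8p3:
  shows "orbit_space = complex_vec ` real_orbit_space
       \<and> real_orbit_space = {z. psd (H_mat z)}"
proof
  define Z :: "real \<Rightarrow> real \<Rightarrow> real^2" where "Z s t = vector [(cos s + cos t + cos (s + t)) / 3,
     (cos (s - t) + cos (s + (s + t)) + cos (t + (s + t))) / 3]" for s t
  have theta: "(\<chi> i. theta i (vector [cis s, cis (s - t)])) = complex_vec (Z s t)" for s t
    by (simp add: vec_eq_iff forall_2 theta_cis complex_vec_def Z_def)
  have Re_theta: "(\<chi> i. Re (theta i (vector [cis s, cis (s - t)]))) = Z s t" for s t
    by (simp add: vec_eq_iff forall_2 theta_cis Z_def)
  have torus: "torus2 = {vector [cis s, cis (s - t)] | s t. True}"
    by (auto simp: vector_cis_in_torus2 elim!: torus2_cis)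
  show "orbit_space = complex_vec ` real_orbit_space"
    unfolding orbit_space_def real_orbit_space_def torus
    by (force simp: theta Re_theta)
  have "psd (H_mat z) \<longleftrightarrow> (\<exists>s t. z = Z s t)" for z
  proof
    assume psd: "psd (H_mat z)"
    show "\<exists>s t. z = Z s t"
    proof (cases z rule: char_roots_cases)
      case (1 a b c)
      \<comment> \<open>\<open>root_le_1_if_psd_H_mat\<close> bounds the first root of a triple; the
        exchange makes it apply to \<open>b\<close>.\<close>
      then have "char_roots z b a c"
        by (simp add: char_roots_def algebra_simps)
      then have "\<bar>a\<bar> \<le> 1" "\<bar>b\<bar> \<le> 1"
        using 1 psd root_le_1_if_psd_H_mat by blast+
      then obtain s t where "a = cos s" "b = cos t" "c = cos (s + t)"
        using char_roots_cosE 1 by blast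
      then have "z = Z s t"
        using 1 char_roots_cos char_roots_inject unfolding Z_def by blast
      then show ?thesis by blast
    next
      case (2 r w)
      then show ?thesis using not_psd_H_mat_if_nonreal_root psd by blast
    qed
  next
    assume "\<exists>s t. z = Z s t"
    then show "psd (H_mat z)"
      unfolding Z_def using psd_H_mat_if_roots_le_1 [OF char_roots_cos] by auto
  qed
  then show "real_orbit_space = {z. psd (H_mat z)}"
    unfolding real_orbit_space_def torus by (force simp: Re_theta)
qed

end
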